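(* Let $S\subset\mathbb{R}^2$ be a finite set of points, not all collinear, such that no four points of $S$ lie on a common circle or a common line. For a triangle $\Delta$ with side lengths $a_1,a_2,a_3$ and area $\mathrm{area}(\Delta)$ let $$hrm(\Delta)=\frac{a_1^2+a_2^2+a_3^2}{\mathrm{area}(\Delta)},$$ and for a triangulation $t$ of $S$ let $hrm(t)=\sum_{\Delta\in t}hrm(\Delta)$. Then a triangulation $t$ of $S$ minimizes $hrm$ over all triangulations of $S$ if and only if $t$ is the Delaunay triangulation of $S$.
   Context: A triangulation of a finite planar set $S$ is a finite collection of nondegenerate triangles whose union is the convex hull of $S$, any two of which intersect in a common (possibly empty) face, and whose set of vertices is exactly $S$; sums over $\Delta\in t$ run over the triangles of $t$. The Delaunay triangulation of $S$ is the straight-line dual of the Voronoi diagram of $S$; equivalently, it consists of the nondegenerate triangles with vertices in $S$ whose open circumscribed disk contains no point of $S$. *)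

theory Defs
  imports "HOL-Analysis.Analysis"
begin

type_synonym point = "real ^ 2"

definition vertices :: "point set \<Rightarrow> point set" where
  "vertices T = {x. x extreme_point_of T}"

text \<open>The library predicate \<^const>\<open>triangulation\<close> covers finiteness and the condition that any
  two members meet in a common (possibly empty) face; it allows simplices of mixed dimension and
  prescribes neither the union nor the vertices. A nondegenerate triangle is a 2-simplex.\<close>

definition triangulation_of :: "point set \<Rightarrow> point set set \<Rightarrow> bool" where
  "triangulation_of S t \<longleftrightarrow>
     triangulation t \<and> (\<forall>T\<in>t. 2 simplex T) \<and> \<Union>t = convex hull S \<and> (\<Union>T\<in>t. vertices T) = S"

text \<open>The sides of a triangle are segments, so the diameter of a side is its length.\<close>

definition hrm_triangle :: "point set \<Rightarrow> real" where
  "hrm_triangle T = (\<Sum>e\<in>{e. e edge_of T}. (diameter e)\<^sup>2) / measure lebesgue T"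

definition hrm :: "point set set \<Rightarrow> real" where
  "hrm t = (\<Sum>T\<in>t. hrm_triangle T)"

definition delaunay :: "point set \<Rightarrow> point set set" where
  "delaunay S = {T. 2 simplex T \<and> vertices T \<subseteq> S \<and>
     (\<exists>c r. vertices T \<subseteq> sphere c r \<and> ball c r \<inter> S = {})}"

lemma vertices_convex_hull:
  fixes C :: "point set"
  assumes "\<not> affine_dependent C"
  shows "vertices (convex hull C) = C"
  using extreme_point_of_convex_hull_affine_independent[OF assms] by (auto simp: vertices_def)

lemma simplex_2_vertices:
  fixes T :: "point set"
  assumes "2 simplex T"
  shows "finite (vertices T)" "card (vertices T) = 3" "\<not> affine_dependent (vertices T)"
    "T = convex hull vertices T"
  using assms unfolding simplex by (auto simp: vertices_convex_hull)

text \<open>Explicit form of \<^const>\<open>hrm_triangle\<close> for a triangle given by its vertices.\<close>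

lemma hrm_triangle_convex_hull:
  fixes a b c :: point
  assumes "\<not> affine_dependent {a, b, c}" "a \<noteq> b" "b \<noteq> c" "a \<noteq> c"
  shows "hrm_triangle (convex hull {a, b, c}) =
     ((dist a b)\<^sup>2 + (dist b c)\<^sup>2 + (dist a c)\<^sup>2) / measure lebesgue (convex hull {a, b, c})"
proof -
  have inj: "convex hull X \<noteq> convex hull Y"
    if "X \<subseteq> {a, b, c}" "Y \<subseteq> {a, b, c}" "X \<noteq> Y" for X Y
    using that vertices_convex_hull[OF affine_independent_subset[OF assms(1) that(1)]]
      vertices_convex_hull[OF affine_independent_subset[OF assms(1) that(2)]] by metis
  have card2: "X \<in> {{a, b}, {b, c}, {a, c}}" if X: "X \<subseteq> {a, b, c}" "card X = 2" for X
  proof -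
    from X(2) obtain x y where "X = {x, y}" "x \<noteq> y" by (auto simp: card_2_iff)
    with X(1) show ?thesis by auto
  qed
  have "{e. e edge_of convex hull {a, b, c}} =
      {convex hull X |X. X \<subseteq> {a, b, c} \<and> card X = 2}"
  proof (intro set_eqI)
    fix e
    have "e edge_of convex hull {a, b, c} \<longleftrightarrow>
        (\<exists>X \<subseteq> {a, b, c}. e = convex hull X \<and> aff_dim (convex hull X) = 1)"
      unfolding edge_of_def face_of_convex_hull_affine_independent[OF assms(1)] by blast
    also have "\<dots> \<longleftrightarrow> (\<exists>X \<subseteq> {a, b, c}. e = convex hull X \<and> card X = 2)"
    proof -
      have "aff_dim (convex hull X) = 1 \<longleftrightarrow> card X = 2" if "X \<subseteq> {a, b, c}" for X
        using aff_dim_affine_independent[OF affine_independent_subset[OF assms(1) that]]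
        unfolding aff_dim_convex_hull by linarith
      then show ?thesis by blast
    qed
    finally show "e \<in> {e. e edge_of convex hull {a, b, c}} \<longleftrightarrow>
        e \<in> {convex hull X |X. X \<subseteq> {a, b, c} \<and> card X = 2}" by blast
  qed
  also have "\<dots> = {convex hull {a, b}, convex hull {b, c}, convex hull {a, c}}"
  proof
    show "{convex hull X |X. X \<subseteq> {a, b, c} \<and> card X = 2} \<subseteq>
        {convex hull {a, b}, convex hull {b, c}, convex hull {a, c}}"
      using card2 by blast
    have "card {a, b} = 2" "card {b, c} = 2" "card {a, c} = 2" using assms by auto
    then show "{convex hull {a, b}, convex hull {b, c}, convex hull {a, c}} \<subseteq>
        {convex hull X |X. X \<subseteq> {a, b, c} \<and> card X = 2}" by blast
  qed
  finally have edges: "{e. e edge_of convex hull {a, b, c}} =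
      {convex hull {a, b}, convex hull {b, c}, convex hull {a, c}}" .
  have dist: "diameter (convex hull {x, y}) = dist x y" for x y :: point
  proof (rule antisym)
    have "dist u v \<le> dist x y" if "u \<in> convex hull {x, y}" "v \<in> convex hull {x, y}" for u v
    proof -
      have "norm (u - v) \<le> norm (x - y)"
        using simplex_extremal_le_exists[OF _ that] by (auto simp: norm_minus_commute)
      then show ?thesis by (simp add: dist_norm)
    qed
    then show "diameter (convex hull {x, y}) \<le> dist x y"
      by (intro diameter_le) (auto simp: dist_norm)
    show "dist x y \<le> diameter (convex hull {x, y})"
      by (rule diameter_bounded_bound) (auto simp: hull_inc bounded_convex_hull)
  qed
  have "{a, b} \<noteq> {b, c}" "{a, b} \<noteq> {a, c}" "{b, c} \<noteq> {a, c}"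
    using assms(2-4) by (simp_all add: doubleton_eq_iff)
  then have "convex hull {a, b} \<noteq> convex hull {b, c}" "convex hull {a, b} \<noteq> convex hull {a, c}"
    "convex hull {b, c} \<noteq> convex hull {a, c}"
    by (simp_all add: inj)
  then show ?thesis
    by (simp add: hrm_triangle_def edges dist)
qed

text \<open>Duality with the Voronoi diagram: the Delaunay triangles are those whose three vertices
  have Voronoi cells with a common point.\<close>

definition voronoi_cell :: "point set \<Rightarrow> point \<Rightarrow> point set" where
  "voronoi_cell S p = {x. \<forall>q\<in>S. dist x p \<le> dist x q}"

lemma delaunay_iff_voronoi:
  "T \<in> delaunay S \<longleftrightarrow>
     2 simplex T \<and> vertices T \<subseteq> S \<and> (\<Inter>p\<in>vertices T. voronoi_cell S p) \<noteq> {}"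
proof (cases "2 simplex T \<and> vertices T \<subseteq> S")
  case True
  then have "vertices T \<noteq> {}" using simplex_2_vertices(2) by fastforce
  then obtain p where p: "p \<in> vertices T" by blast
  have "(\<exists>c r. vertices T \<subseteq> sphere c r \<and> ball c r \<inter> S = {}) \<longleftrightarrow>
      (\<exists>c. \<forall>p\<in>vertices T. c \<in> voronoi_cell S p)"
  proof safe
    fix c r assume "vertices T \<subseteq> sphere c r" "ball c r \<inter> S = {}"
    then have "\<forall>p\<in>vertices T. c \<in> voronoi_cell S p"
      by (fastforce simp: voronoi_cell_def disjoint_iff not_less)
    then show "\<exists>c. \<forall>p\<in>vertices T. c \<in> voronoi_cell S p" ..
  next
    fix c assume c: "\<forall>p\<in>vertices T. c \<in> voronoi_cell S p"
    then have le: "dist c q \<le> dist c x" if "q \<in> vertices T" "x \<in> S" for q x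
      using that by (auto simp: voronoi_cell_def)
    have "dist c q = dist c p" if "q \<in> vertices T" for q
      using le[OF that, of p] le[OF p, of q] that p True by (simp add: subset_iff)
    then have "vertices T \<subseteq> sphere c (dist c p)" by auto
    moreover have "ball c (dist c p) \<inter> S = {}"
      using le[OF p] by (metis disjoint_iff leD mem_ball)
    ultimately show "\<exists>c r. vertices T \<subseteq> sphere c r \<and> ball c r \<inter> S = {}" by blast
  qed
  also have "\<dots> \<longleftrightarrow> (\<Inter>p\<in>vertices T. voronoi_cell S p) \<noteq> {}" by blast
  finally show ?thesis using True unfolding delaunay_def by blast
qed (auto simp: delaunay_def)

end

theory Submission
  imports Defs
begin

text \<open>There are finitely many triangulations, so a minimizer exists, and it suffices that every
  triangulation other than the Delaunay one can be improved.

  Write the power of a point \<open>x\<close> with respect to the circumcircle of \<open>T\<close> as \<open>P T x\<close>. The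
  difference of two such functions is affine. If all triangles of \<open>t\<close> are Delaunay, a Delaunay
  triangle overlapping some member of \<open>t\<close> has the same circumcircle, hence equals it. Otherwise some
  \<open>p\<close> in \<open>S\<close> has \<open>P T p < 0\<close>; choose \<open>T\<close> to minimize \<open>P T p\<close>. Let \<open>a b\<close> be an edge of \<open>T = a b c\<close>
  separating it from \<open>p\<close> and \<open>X = a b d\<close> its neighbour. The function \<open>P T - P X\<close> vanishes on the line
  \<open>a b\<close>, so minimality forces \<open>P T d < 0\<close>: the edge \<open>a b\<close> is not locally Delaunay. Then the segments
  \<open>a b\<close> and \<open>c d\<close> cross at a point \<open>m\<close>, and comparing the power of \<open>m\<close> along both segments gives
  \<open>|m c| |m d| < |m a| |m b|\<close>, which is what makes the flip of \<open>a b\<close> to \<open>c d\<close> decrease the sum.\<close>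

section \<open>Triangles in the plane\<close>

text \<open>Twice the signed area. For fixed \<open>a\<close> and \<open>b\<close> it is affine in
  the third point, and for \<open>a \<noteq> b\<close> its sign tells the side of the line
  \<open>a b\<close>.\<close>

definition orient :: "point \<Rightarrow> point \<Rightarrow> point \<Rightarrow> real" where
  "orient a b c = (b $ 1 - a $ 1) * (c $ 2 - a $ 2) - (b $ 2 - a $ 2) * (c $ 1 - a $ 1)"

lemma orient_affine:
  assumes "u + v + w = 1"
  shows "orient a b (u *\<^sub>R x + v *\<^sub>R y + w *\<^sub>R z) = u * orient a b x + v * orient a b y + w * orient a b z"
proof -
  have u: "u = 1 - v - w" using assms by simp
  show ?thesis unfolding u by (simp add: orient_def algebra_simps)
qed

lemma orient_degenerate [simp]: "orient a b a = 0" "orient a b b = 0" "orient a a b = 0"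
  by (simp_all add: orient_def)

lemma orient_rotate: "orient b c a = orient a b c" "orient c a b = orient a b c"
  by (simp_all add: orient_def algebra_simps)

lemma orient_swap: "orient a c b = - orient a b c" "orient b a c = - orient a b c"
  by (simp_all add: orient_def algebra_simps)

text \<open>Cramer's rule with the denominator cleared, so that it is a polynomial identity.\<close>

lemma orient_barycentric:
  "orient a b c *\<^sub>R p = orient p b c *\<^sub>R a + orient a p c *\<^sub>R b + orient a b p *\<^sub>R c"
  "orient a b c = orient p b c + orient a p c + orient a b p"
  by (simp_all add: orient_def vec_eq_iff forall_2 algebra_simps)

lemma barycentric_coordinates:
  assumes "orient a b c \<noteq> 0"
  shows "orient p b c / orient a b c + orient a p c / orient a b c + orient a b p / orient a b c = 1"
    and "p = (orient p b c / orient a b c) *\<^sub>R a + (orient a p c / orient a b c) *\<^sub>R b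
      + (orient a b p / orient a b c) *\<^sub>R c"
proof -
  let ?o = "orient a b c"
  show "orient p b c / ?o + orient a p c / ?o + orient a b p / ?o = 1"
    using assms orient_barycentric(2)[of a b c p] by (simp flip: add_divide_distrib)
  have "p = (1 / ?o) *\<^sub>R (?o *\<^sub>R p)" using assms by simp
  also have "\<dots> = (orient p b c / ?o) *\<^sub>R a + (orient a p c / ?o) *\<^sub>R b + (orient a b p / ?o) *\<^sub>R c"
    by (subst orient_barycentric(1)) (simp add: algebra_simps)
  finally show "p = \<dots>" .
qed

text \<open>The parameter is read off in a coordinate in which \<open>a\<close> and \<open>b\<close>
  differ.\<close>

lemma orient_eq_0_imp_on_line:
  assumes "orient a b x = 0" "a \<noteq> b"
  obtains s where "x = (1 - s) *\<^sub>R a + s *\<^sub>R b"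
proof (cases "a $ 1 = b $ 1")
  case True
  then have ne: "a $ 2 \<noteq> b $ 2" using assms(2) by (auto simp: vec_eq_iff forall_2)
  then have x1: "x $ 1 = a $ 1" using assms(1) True by (simp add: orient_def)
  define s where "s = (x $ 2 - a $ 2) / (b $ 2 - a $ 2)"
  have "x $ 2 - a $ 2 = s * (b $ 2 - a $ 2)" using ne by (simp add: s_def)
  with True x1 have "x = (1 - s) *\<^sub>R a + s *\<^sub>R b"
    by (simp add: vec_eq_iff forall_2 algebra_simps)
  then show ?thesis by (rule that)
next
  case False
  define s where "s = (x $ 1 - a $ 1) / (b $ 1 - a $ 1)"
  have 1: "x $ 1 - a $ 1 = s * (b $ 1 - a $ 1)" using False by (simp add: s_def)
  then have "(b $ 1 - a $ 1) * (x $ 2 - a $ 2) = (b $ 1 - a $ 1) * (s * (b $ 2 - a $ 2))"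
    using assms(1) unfolding orient_def by algebra
  then have "x $ 2 - a $ 2 = s * (b $ 2 - a $ 2)" using False by simp
  with 1 have "x = (1 - s) *\<^sub>R a + s *\<^sub>R b"
    by (simp add: vec_eq_iff forall_2 algebra_simps)
  then show ?thesis by (rule that)
qed

lemma collinear_iff_orient: "collinear {a, b, c} \<longleftrightarrow> orient a b c = 0"
proof
  assume "collinear {a, b, c}"
  then consider "a = c" | u where "b = u *\<^sub>R a + (1 - u) *\<^sub>R c"
    unfolding collinear_3_expand by blast
  then show "orient a b c = 0"
  proof cases
    case (2 u)
    show ?thesis unfolding 2 by (simp add: orient_def algebra_simps)
  qed simp
next
  assume o: "orient a b c = 0"
  show "collinear {a, b, c}"
  proof (cases "a = c")
    case False
    have "orient a c b = 0" using o orient_swap(1)[of a c b] by simp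
    with False obtain s where "b = (1 - s) *\<^sub>R a + s *\<^sub>R c" by (metis orient_eq_0_imp_on_line)
    then show ?thesis unfolding collinear_3_expand by (intro disjI2 exI[of _ "1 - s"]) simp
  qed (simp add: collinear_3_expand)
qed

lemma orient_nonzero_distinct:
  assumes "orient a b c \<noteq> 0" shows "a \<noteq> b" "b \<noteq> c" "a \<noteq> c"
  using assms by (auto simp: orient_def)

lemma orient_nonzero_imp_independent:
  "orient a b c \<noteq> 0 \<Longrightarrow> \<not> affine_dependent {a, b, c}"
  using collinear_iff_orient[of a b c] by (simp add: collinear_3_eq_affine_dependent)

lemma triangle_simplex:
  assumes "orient a b c \<noteq> 0"
  shows "2 simplex convex hull {a, b, c}" "vertices (convex hull {a, b, c}) = {a, b, c}"
proof -
  note i = orient_nonzero_imp_independent[OF assms]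
  show "vertices (convex hull {a, b, c}) = {a, b, c}" by (rule vertices_convex_hull[OF i])
  have "card {a, b, c} = 3" using orient_nonzero_distinct[OF assms] by simp
  with i show "2 simplex convex hull {a, b, c}" unfolding simplex_def by auto
qed

lemma simplex_2_with_vertices:
  assumes "2 simplex T" "a \<in> vertices T" "b \<in> vertices T" "a \<noteq> b"
  obtains c where "orient a b c \<noteq> 0" "T = convex hull {a, b, c}" "vertices T = {a, b, c}"
proof -
  have "card (vertices T - {a, b}) = 1"
    using simplex_2_vertices(1,2)[OF assms(1)] assms by (simp add: card_Diff_subset)
  then obtain c where "vertices T - {a, b} = {c}" by (meson card_1_singletonE)
  then have v: "vertices T = {a, b, c}" "c \<noteq> a" "c \<noteq> b" using assms by auto
  then have "\<not> collinear {a, b, c}"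
    using simplex_2_vertices(3)[OF assms(1)] assms(4) unfolding collinear_3_eq_affine_dependent by auto
  then have "orient a b c \<noteq> 0" by (simp add: collinear_iff_orient)
  moreover have "T = convex hull {a, b, c}" using simplex_2_vertices(4)[OF assms(1)] unfolding v(1) .
  ultimately show ?thesis using that v(1) by blast
qed

lemma simplex_2E:
  assumes "2 simplex T"
  obtains a b c where "orient a b c \<noteq> 0" "T = convex hull {a, b, c}" "vertices T = {a, b, c}"
proof -
  obtain a b c where "vertices T = {a, b, c}" "a \<noteq> b"
    using simplex_2_vertices(2)[OF assms] unfolding card_3_iff by blast
  then have "a \<in> vertices T" "b \<in> vertices T" "a \<noteq> b" by auto
  then show ?thesis using simplex_2_with_vertices[OF assms] that by metis
qed

section \<open>Interiors of triangles and of finite unions, and circumcircles\<close>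

lemma interior_simplex_2_nonempty:
  fixes T :: "point set"
  assumes "2 simplex T"
  shows "interior T \<noteq> {}"
proof -
  have "T \<noteq> {}" using assms by auto
  then have "rel_interior T \<noteq> {}" using rel_interior_eq_empty[OF convex_simplex[OF assms]] by simp
  moreover have "aff_dim T = int DIM(point)" using aff_dim_simplex[OF assms] by simp
  ultimately show ?thesis by (metis interior_rel_interior_gen)
qed

text \<open>A proper face has smaller dimension than \<open>T\<close>, hence dimension below
  2.\<close>

lemma interior_proper_face_empty:
  fixes T :: "point set"
  assumes "convex T" "F face_of T" "F \<noteq> T"
  shows "interior F = {}"
  using face_of_aff_dim_lt[OF assms] aff_dim_nonempty_interior[of F] aff_dim_le_DIM[of T]
  by linarith

lemma interior_Union_closed_empty:
  assumes "finite F" "\<And>X. X \<in> F \<Longrightarrow> closed X" "\<And>X. X \<in> F \<Longrightarrow> interior X = {}"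
  shows "interior (\<Union>F) = {}"
  using assms
proof (induction F rule: finite_induct)
  case (insert X F)
  then show ?case by (simp add: interior_closed_Un_empty_interior)
qed simp

lemma interior_meets_member:
  assumes "finite t" "\<And>X. X \<in> t \<Longrightarrow> closed X" "closed T" "interior T \<noteq> {}" "T \<subseteq> \<Union>t"
  obtains X where "X \<in> t" "interior (T \<inter> X) \<noteq> {}"
proof -
  have "T = \<Union>((\<inter>) T ` t)" using assms(5) by blast
  moreover have "interior (\<Union>((\<inter>) T ` t)) = {}" if "\<And>X. X \<in> t \<Longrightarrow> interior (T \<inter> X) = {}"
    by (rule interior_Union_closed_empty) (use assms that in auto)
  ultimately show ?thesis using that assms(4) by metis
qed

text \<open>A short step in the direction \<open>w\<close> stays in \<open>G\<close> but would raise
  the inner product with \<open>w\<close> if \<open>w\<close> were nonzero.\<close>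

lemma affine_vanishing_on_open:
  fixes w :: "'a::real_inner"
  assumes "open G" "G \<noteq> {}" "\<And>x. x \<in> G \<Longrightarrow> w \<bullet> x = k"
  shows "w = 0" "k = 0"
proof -
  obtain x where x: "x \<in> G" using assms(2) by blast
  then obtain e where e: "e > 0" "ball x e \<subseteq> G" using assms(1) by (meson openE)
  show "w = 0"
  proof (rule ccontr)
    assume w: "w \<noteq> 0"
    let ?y = "x + (e / (2 * norm w)) *\<^sub>R w"
    have "?y \<in> ball x e" using w e(1) by (simp add: dist_norm)
    then have "w \<bullet> ?y = w \<bullet> x" using e(2) assms(3) x by (metis subsetD)
    then show False using w e(1) by (simp add: inner_add_right)
  qed
  then show "k = 0" using assms(3)[OF x] by simp
qed

lemma circumcircle_exists:
  assumes "orient a b c \<noteq> 0"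
  obtains z r where "{a, b, c} \<subseteq> sphere z r"
proof -
  define D where "D = 2 * orient a b c"
  define B where "B = (b $ 1 - a $ 1)\<^sup>2 + (b $ 2 - a $ 2)\<^sup>2"
  define C where "C = (c $ 1 - a $ 1)\<^sup>2 + (c $ 2 - a $ 2)\<^sup>2"
  \<comment> \<open>In coordinates relative to \<open>a\<close>, equal distance of the centre to
    \<open>a\<close> and \<open>b\<close> and to \<open>a\<close> and \<open>c\<close> is a linear
    system with right-hand sides \<open>B\<close> and \<open>C\<close>; this is its solution by
    Cramer's rule.\<close>
  define z :: point where "z = vector [a $ 1 + ((c $ 2 - a $ 2) * B - (b $ 2 - a $ 2) * C) / D,
     a $ 2 + ((b $ 1 - a $ 1) * C - (c $ 1 - a $ 1) * B) / D]"
  define z1 where "z1 = z $ 1 - a $ 1"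
  define z2 where "z2 = z $ 2 - a $ 2"
  have D: "D \<noteq> 0" using assms by (simp add: D_def)
  have z: "D * z1 = (c $ 2 - a $ 2) * B - (b $ 2 - a $ 2) * C"
    "D * z2 = (b $ 1 - a $ 1) * C - (c $ 1 - a $ 1) * B"
    using D by (simp_all add: z1_def z2_def z_def)
  have "D * (2 * (z1 * (b $ 1 - a $ 1) + z2 * (b $ 2 - a $ 2))) = D * B"
    using z by (simp add: D_def orient_def) algebra
  then have b: "2 * (z1 * (b $ 1 - a $ 1) + z2 * (b $ 2 - a $ 2)) = B" using D by simp
  have "D * (2 * (z1 * (c $ 1 - a $ 1) + z2 * (c $ 2 - a $ 2))) = D * C"
    using z by (simp add: D_def orient_def) algebra
  then have c: "2 * (z1 * (c $ 1 - a $ 1) + z2 * (c $ 2 - a $ 2)) = C" using D by simp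
  have d: "(dist z x)\<^sup>2 = (z $ 1 - x $ 1)\<^sup>2 + (z $ 2 - x $ 2)\<^sup>2" for x :: point
    by (simp add: dist_norm norm_eq_sqrt_inner inner_vec_def sum_2 power2_eq_square)
  have "(dist z b)\<^sup>2 = (dist z a)\<^sup>2" "(dist z c)\<^sup>2 = (dist z a)\<^sup>2"
    using b c unfolding d B_def C_def z1_def z2_def unfolding power2_eq_square by (simp_all add: algebra_simps)
  then have "{a, b, c} \<subseteq> sphere z (dist z a)" by (simp add: power2_eq_iff_nonneg)
  then show ?thesis by (rule that)
qed

section \<open>The effect of a flip on the harmonic index\<close>

lemma hrm_triangle_nonneg: "hrm_triangle T \<ge> 0"
  by (simp add: hrm_triangle_def sum_nonneg)

lemma hrm_triangle_orient:
  assumes "orient a b c \<noteq> 0"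
  shows "hrm_triangle (convex hull {a, b, c}) =
    2 * ((dist a b)\<^sup>2 + (dist b c)\<^sup>2 + (dist a c)\<^sup>2) / \<bar>orient a b c\<bar>"
proof -
  have "measure lebesgue (convex hull {a, b, c}) = measure lborel (convex hull {a, b, c})"
    by (intro measure_completion) (simp add: borel_closed compact_imp_closed finite_imp_compact_convex_hull)
  also have "\<dots> = \<bar>orient a b c\<bar> / 2"
    unfolding content_triangle orient_def by (simp add: algebra_simps abs_minus_commute)
  finally have "measure lebesgue (convex hull {a, b, c}) = \<bar>orient a b c\<bar> / 2" .
  then show ?thesis
    unfolding hrm_triangle_convex_hull[OF orient_nonzero_imp_independent[OF assms] orient_nonzero_distinct[OF assms]]
    by (simp only: divide_divide_eq_right mult.commute)
qed

text \<open>The condition on \<open>orient\<close> keeps the two segments from lying on one line.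
  The four points then form a strictly convex quadrilateral with diagonals \<open>a b\<close> and
  \<open>c d\<close>.\<close>

definition crossing :: "point \<Rightarrow> point \<Rightarrow> point \<Rightarrow> point \<Rightarrow> point \<Rightarrow> bool" where
  "crossing a b c d m \<longleftrightarrow> orient a b c \<noteq> 0 \<and> m \<in> open_segment a b \<and> m \<in> open_segment c d"

text \<open>The positions \<alpha> and \<tau> of \<open>m\<close> on the diagonals determine how
  each diagonal divides the area; \<open>\<bar>s\<bar>\<close> is twice the area of the
  quadrilateral.\<close>

lemma crossing_param:
  assumes "crossing a b c d m"
  obtains \<alpha> \<tau> s where "0 < \<alpha>" "\<alpha> < 1" "0 < \<tau>" "\<tau> < 1" "s \<noteq> 0"
    "m = (1 - \<alpha>) *\<^sub>R a + \<alpha> *\<^sub>R b" "m = (1 - \<tau>) *\<^sub>R c + \<tau> *\<^sub>R d"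
    "orient a b c = - \<tau> * s" "orient a b d = (1 - \<tau>) * s"
    "orient c d a = \<alpha> * s" "orient c d b = - (1 - \<alpha>) * s"
proof -
  obtain \<alpha> where \<alpha>: "0 < \<alpha>" "\<alpha> < 1" "m = (1 - \<alpha>) *\<^sub>R a + \<alpha> *\<^sub>R b"
    using assms unfolding crossing_def in_segment by blast
  obtain \<tau> where \<tau>: "0 < \<tau>" "\<tau> < 1" "m = (1 - \<tau>) *\<^sub>R c + \<tau> *\<^sub>R d"
    using assms unfolding crossing_def in_segment by blast
  define s where "s = orient a b d - orient a b c"
  have eq: "(1 - \<alpha>) * a $ i + \<alpha> * b $ i = (1 - \<tau>) * c $ i + \<tau> * d $ i" for i
    using arg_cong[OF trans[OF sym[OF \<alpha>(3)] \<tau>(3)], of "\<lambda>x. x $ i"] by simp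
  have "orient a b c = - \<tau> * s" "orient a b d = (1 - \<tau>) * s"
    "orient c d a = \<alpha> * s" "orient c d b = - (1 - \<alpha>) * s"
    using eq[of 1] eq[of 2] unfolding s_def orient_def by algebra+
  moreover from this have "s \<noteq> 0" using assms unfolding crossing_def by auto
  ultimately show ?thesis using that \<alpha> \<tau> by blast
qed

lemma crossing_sym:
  assumes "crossing a b c d m"
  shows "crossing b a c d m" "crossing a b d c m" "crossing c d a b m"
proof -
  obtain \<alpha> \<tau> s where "0 < \<alpha>" "\<alpha> < 1" "0 < \<tau>" "\<tau> < 1" "s \<noteq> 0"
    "orient a b d = (1 - \<tau>) * s" "orient c d a = \<alpha> * s"
    using crossing_param[OF assms] by metis
  then have "orient a b d \<noteq> 0" "orient c d a \<noteq> 0" "orient b a c \<noteq> 0"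
    using assms unfolding crossing_def orient_swap(2)[of a b c] by simp_all
  then show "crossing b a c d m" "crossing a b d c m" "crossing c d a b m"
    using assms unfolding crossing_def
    unfolding open_segment_commute[of b a] open_segment_commute[of d c] by blast+
qed

lemma norm_sq_combination:
  fixes u v :: "'a::real_inner"
  shows "(norm (x *\<^sub>R u + y *\<^sub>R v))\<^sup>2 = x\<^sup>2 * (norm u)\<^sup>2 + 2 * (x * y) * (u \<bullet> v) + y\<^sup>2 * (norm v)\<^sup>2"
  unfolding power2_norm_eq_inner inner_add_left inner_add_right inner_scaleR_left inner_scaleR_right
  by (simp add: inner_commute[of v u] power2_eq_square algebra_simps)

text \<open>With \<open>p = \<alpha> * (1 - \<alpha>)\<close> and
  \<open>q = \<tau> * (1 - \<tau>)\<close>, clearing denominators turns the difference of the two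
  sides into \<open>2 * (p * A - q * B) * (1 - p - q)\<close>. The last factor is positive since
  \<open>p\<close> and \<open>q\<close> are at most 1/4.\<close>

lemma flip_inequality:
  fixes A B :: real
  assumes "0 < \<alpha>" "\<alpha> < 1" "0 < \<tau>" "\<tau> < 1" "\<tau> * (1 - \<tau>) * B < \<alpha> * (1 - \<alpha>) * A"
  shows "(B + ((1 - \<tau>)\<^sup>2 + \<tau>\<^sup>2) * B) / (\<alpha> * (1 - \<alpha>)) + 2 * A
    < (A + ((1 - \<alpha>)\<^sup>2 + \<alpha>\<^sup>2) * A) / (\<tau> * (1 - \<tau>)) + 2 * B"
proof -
  define p where "p = \<alpha> * (1 - \<alpha>)"
  define q where "q = \<tau> * (1 - \<tau>)"
  have "p \<le> 1/4" "q \<le> 1/4"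
    using zero_le_power2[of "\<alpha> - 1/2"] zero_le_power2[of "\<tau> - 1/2"]
    by (simp_all add: p_def q_def power2_eq_square algebra_simps)
  moreover have pq: "0 < p" "0 < q" using assms by (simp_all add: p_def q_def)
  ultimately have "(q * B) * (1 - p - q) < (p * A) * (1 - p - q)"
    using assms(5) by (intro mult_strict_right_mono) (auto simp: p_def q_def)
  then have "q * (B * (2 - 2 * q) + 2 * A * p) < p * (A * (2 - 2 * p) + 2 * B * q)"
    by (simp add: algebra_simps)
  then have "B * (2 - 2 * q) / p + 2 * A < A * (2 - 2 * p) / q + 2 * B"
    using pq by (simp add: field_simps)
  moreover have "B + ((1 - \<tau>)\<^sup>2 + \<tau>\<^sup>2) * B = B * (2 - 2 * q)"
    "A + ((1 - \<alpha>)\<^sup>2 + \<alpha>\<^sup>2) * A = A * (2 - 2 * p)"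
    by (simp_all add: p_def q_def power2_eq_square algebra_simps)
  ultimately show ?thesis by (simp add: p_def q_def)
qed

text \<open>The terms with the inner product of the two diagonals cancel.\<close>

lemma hrm_pair:
  assumes "crossing a b c d m" "0 < \<alpha>" "\<alpha> < 1" "0 < \<tau>" "\<tau> < 1" "s \<noteq> 0"
    "m = (1 - \<alpha>) *\<^sub>R a + \<alpha> *\<^sub>R b" "m = (1 - \<tau>) *\<^sub>R c + \<tau> *\<^sub>R d"
    "\<bar>orient a b c\<bar> = \<tau> * \<bar>s\<bar>" "\<bar>orient a b d\<bar> = (1 - \<tau>) * \<bar>s\<bar>"
  shows "hrm_triangle (convex hull {a, b, c}) + hrm_triangle (convex hull {a, b, d}) =
    2 / \<bar>s\<bar> * (((dist a b)\<^sup>2 + ((1 - \<alpha>)\<^sup>2 + \<alpha>\<^sup>2) * (dist a b)\<^sup>2) / (\<tau> * (1 - \<tau>)) + 2 * (dist c d)\<^sup>2)"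
proof -
  define u where "u = b - a"
  define v where "v = d - c"
  define A where "A = (norm u)\<^sup>2"
  define B where "B = (norm v)\<^sup>2"
  define K where "K = u \<bullet> v"
  note defs = u_def v_def
  have m: "(1 - \<alpha>) *\<^sub>R a + \<alpha> *\<^sub>R b = (1 - \<tau>) *\<^sub>R c + \<tau> *\<^sub>R d" using assms by simp
  \<comment> \<open>The two expressions for \<open>m\<close> give \<open>c\<close> in terms of
    \<open>a\<close>, \<open>u\<close> and \<open>v\<close>, so every side vector is a combination
    of the diagonal vectors.\<close>
  have ca: "c = a + \<alpha> *\<^sub>R u - \<tau> *\<^sub>R v" using m by (simp add: defs algebra_simps)
  have "a - c = (- \<alpha>) *\<^sub>R u + \<tau> *\<^sub>R v" "b - c = (1 - \<alpha>) *\<^sub>R u + \<tau> *\<^sub>R v"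
    "a - d = (- \<alpha>) *\<^sub>R u + (- (1 - \<tau>)) *\<^sub>R v" "b - d = (1 - \<alpha>) *\<^sub>R u + (- (1 - \<tau>)) *\<^sub>R v"
    using ca by (simp_all add: defs algebra_simps)
  then have d: "(dist a c)\<^sup>2 = \<alpha>\<^sup>2 * A - 2 * (\<alpha> * \<tau>) * K + \<tau>\<^sup>2 * B"
    "(dist b c)\<^sup>2 = (1 - \<alpha>)\<^sup>2 * A + 2 * ((1 - \<alpha>) * \<tau>) * K + \<tau>\<^sup>2 * B"
    "(dist a d)\<^sup>2 = \<alpha>\<^sup>2 * A + 2 * (\<alpha> * (1 - \<tau>)) * K + (1 - \<tau>)\<^sup>2 * B"
    "(dist b d)\<^sup>2 = (1 - \<alpha>)\<^sup>2 * A - 2 * ((1 - \<alpha>) * (1 - \<tau>)) * K + (1 - \<tau>)\<^sup>2 * B"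
    unfolding dist_norm A_def B_def K_def by (simp_all only: norm_sq_combination) (simp_all add: power2_eq_square algebra_simps)
  have AB: "(dist a b)\<^sup>2 = A" "(dist c d)\<^sup>2 = B"
    by (simp_all add: A_def B_def defs dist_norm norm_minus_commute)
  have o: "orient a b c \<noteq> 0" "orient a b d \<noteq> 0"
    using crossing_sym[OF assms(1)] assms(1) by (auto simp: crossing_def)
  have "hrm_triangle (convex hull {a, b, c}) + hrm_triangle (convex hull {a, b, d}) =
    2 / \<bar>s\<bar> * (((dist a b)\<^sup>2 + (dist b c)\<^sup>2 + (dist a c)\<^sup>2) / \<tau> + ((dist a b)\<^sup>2 + (dist b d)\<^sup>2 + (dist a d)\<^sup>2) / (1 - \<tau>))"
    using assms(2-6) unfolding hrm_triangle_orient[OF o(1)] hrm_triangle_orient[OF o(2)] assms(9,10)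
    by (simp add: distrib_left add_divide_distrib mult.commute[of _ "\<bar>s\<bar>"])
  also have "((dist a b)\<^sup>2 + (dist b c)\<^sup>2 + (dist a c)\<^sup>2) / \<tau> =
      (A + ((1 - \<alpha>)\<^sup>2 + \<alpha>\<^sup>2) * A) / \<tau> + 2 * (1 - 2 * \<alpha>) * K + 2 * \<tau> * B"
    using assms(4) unfolding d AB by (simp add: field_simps power2_eq_square)
  also have "((dist a b)\<^sup>2 + (dist b d)\<^sup>2 + (dist a d)\<^sup>2) / (1 - \<tau>) =
      (A + ((1 - \<alpha>)\<^sup>2 + \<alpha>\<^sup>2) * A) / (1 - \<tau>) - 2 * (1 - 2 * \<alpha>) * K + 2 * (1 - \<tau>) * B"
  proof -
    have "x = (y + \<sigma> * z) / \<sigma> \<Longrightarrow> x = y / \<sigma> + z" if "\<sigma> \<noteq> 0" for x y z \<sigma> :: real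
      using that by (simp add: add_divide_distrib)
    from this[of "1 - \<tau>" _ "A + ((1 - \<alpha>)\<^sup>2 + \<alpha>\<^sup>2) * A" "- 2 * (1 - 2 * \<alpha>) * K + 2 * (1 - \<tau>) * B"]
    show ?thesis
      using assms(5) unfolding d AB by (simp add: algebra_simps power2_eq_square)
  qed
  also have "(A + ((1 - \<alpha>)\<^sup>2 + \<alpha>\<^sup>2) * A) / \<tau> + 2 * (1 - 2 * \<alpha>) * K + 2 * \<tau> * B +
      ((A + ((1 - \<alpha>)\<^sup>2 + \<alpha>\<^sup>2) * A) / (1 - \<tau>) - 2 * (1 - 2 * \<alpha>) * K + 2 * (1 - \<tau>) * B) =
      (A + ((1 - \<alpha>)\<^sup>2 + \<alpha>\<^sup>2) * A) / (\<tau> * (1 - \<tau>)) + 2 * B"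
  proof -
    have "N / \<tau> + N / (1 - \<tau>) = N / (\<tau> * (1 - \<tau>))" for N
      using assms(4,5) by (simp add: divide_simps) (simp add: algebra_simps)
    from this[symmetric] show ?thesis by (simp add: algebra_simps)
  qed
  finally show ?thesis unfolding AB .
qed

text \<open>Stewart's theorem. On a chord of a circle it makes the power of a point minus the
  product of its distances to the endpoints.\<close>

lemma power_combination:
  fixes z :: "'a::real_inner"
  shows "(dist z ((1 - t) *\<^sub>R x + t *\<^sub>R y))\<^sup>2 =
    (1 - t) * (dist z x)\<^sup>2 + t * (dist z y)\<^sup>2 - t * (1 - t) * (dist x y)\<^sup>2"
  by (simp add: dist_norm power2_norm_eq_inner inner_diff_left inner_diff_right inner_add_left
      inner_add_right inner_commute) (simp add: algebra_simps)

text \<open>\<open>hrm_pair\<close>, applied to either diagonal, gives both sums the same factor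
  \<open>2 / \<bar>s\<bar>\<close>, with the roles of the diagonals exchanged. What remains is
  \<open>flip_inequality\<close>.\<close>

lemma flip_decreases_hrm:
  assumes "crossing a b c d m" "{a, b, c} \<subseteq> sphere z r" "d \<in> ball z r"
  shows "hrm_triangle (convex hull {c, d, a}) + hrm_triangle (convex hull {c, d, b})
    < hrm_triangle (convex hull {a, b, c}) + hrm_triangle (convex hull {a, b, d})"
proof -
  obtain \<alpha> \<tau> s where p: "0 < \<alpha>" "\<alpha> < 1" "0 < \<tau>" "\<tau> < 1" "s \<noteq> 0"
    "m = (1 - \<alpha>) *\<^sub>R a + \<alpha> *\<^sub>R b" "m = (1 - \<tau>) *\<^sub>R c + \<tau> *\<^sub>R d"
    "orient a b c = - \<tau> * s" "orient a b d = (1 - \<tau>) * s"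
    "orient c d a = \<alpha> * s" "orient c d b = - (1 - \<alpha>) * s"
    using crossing_param[OF assms(1)] by metis
  \<comment> \<open>The power of \<open>m\<close> is computed exactly along the chord
    \<open>a b\<close>, then bounded along \<open>c d\<close>, whose endpoint \<open>d\<close> has
    negative power.\<close>
  have "(dist z m)\<^sup>2 = r\<^sup>2 - \<alpha> * (1 - \<alpha>) * (dist a b)\<^sup>2"
    unfolding p(6) power_combination using assms(2) by (simp add: algebra_simps)
  moreover have "(dist z m)\<^sup>2 < r\<^sup>2 - \<tau> * (1 - \<tau>) * (dist c d)\<^sup>2"
  proof -
    have "(dist z d)\<^sup>2 < r\<^sup>2" using assms(3) by (auto intro: power_strict_mono)
    then have "\<tau> * (dist z d)\<^sup>2 < \<tau> * r\<^sup>2" using p by simp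
    moreover have "(1 - \<tau>) * (dist z c)\<^sup>2 = (1 - \<tau>) * r\<^sup>2" using assms(2) by simp
    ultimately show ?thesis unfolding p(7) power_combination by (simp add: algebra_simps)
  qed
  ultimately have D: "\<tau> * (1 - \<tau>) * (dist c d)\<^sup>2 < \<alpha> * (1 - \<alpha>) * (dist a b)\<^sup>2" by linarith
  have "hrm_triangle (convex hull {a, b, c}) + hrm_triangle (convex hull {a, b, d}) =
    2 / \<bar>s\<bar> * (((dist a b)\<^sup>2 + ((1 - \<alpha>)\<^sup>2 + \<alpha>\<^sup>2) * (dist a b)\<^sup>2) / (\<tau> * (1 - \<tau>)) + 2 * (dist c d)\<^sup>2)"
    using p by (intro hrm_pair[OF assms(1)]) (auto simp: abs_mult)
  moreover have "hrm_triangle (convex hull {c, d, a}) + hrm_triangle (convex hull {c, d, b}) =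
    2 / \<bar>s\<bar> * (((dist c d)\<^sup>2 + ((1 - \<tau>)\<^sup>2 + \<tau>\<^sup>2) * (dist c d)\<^sup>2) / (\<alpha> * (1 - \<alpha>)) + 2 * (dist a b)\<^sup>2)"
    using p by (intro hrm_pair[OF crossing_sym(3)[OF assms(1)]]) (auto simp: abs_mult)
  moreover have "2 / \<bar>s\<bar> > 0" using p(5) by simp
  note mult_strict_left_mono[OF flip_inequality[OF p(1-4) D] this]
  ultimately show ?thesis by simp
qed

section \<open>Flips preserve triangulations\<close>

text \<open>Induction on \<open>F\<close>: adjoining \<open>x\<close> replaces a hull by the union
  of the segments from \<open>x\<close> to its points, which respects the splitting. The base case
  cuts the segment \<open>c d\<close> at \<open>m\<close>.\<close>

lemma convex_hull_split:
  fixes m :: "'a::euclidean_space"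
  assumes "finite F" "m \<in> closed_segment c d"
  shows "convex hull ({c, d} \<union> F) \<subseteq> convex hull ({c, m} \<union> F) \<union> convex hull ({m, d} \<union> F)"
  using assms(1)
proof (induction F rule: finite_induct)
  case empty
  then show ?case
    using Un_closed_segment[OF assms(2)] by (simp flip: segment_convex_hull)
next
  case (insert x F)
  have seg: "convex hull (insert x G) = (\<Union>y\<in>convex hull G. closed_segment x y)" if "G \<noteq> {}" for G
    using that by (simp add: convex_hull_insert_segments)
  have "convex hull ({c, d} \<union> insert x F) = (\<Union>y\<in>convex hull ({c, d} \<union> F). closed_segment x y)"
    using seg[of "{c, d} \<union> F"] by (simp add: insert_commute)
  also have "\<dots> \<subseteq> (\<Union>y\<in>convex hull ({c, m} \<union> F) \<union> convex hull ({m, d} \<union> F). closed_segment x y)"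
    using insert.IH by blast
  also have "\<dots> = convex hull ({c, m} \<union> insert x F) \<union> convex hull ({m, d} \<union> insert x F)"
    using seg[of "{c, m} \<union> F"] seg[of "{m, d} \<union> F"] by (simp add: insert_commute)
  finally show ?case .
qed

lemma crossing_in_segments:
  assumes "crossing a b c d m"
  shows "m \<in> closed_segment a b" "m \<in> closed_segment c d"
  using assms segment_open_subset_closed unfolding crossing_def by blast+

text \<open>Cut the hull at \<open>m\<close> along \<open>c d\<close>. As \<open>m\<close> also lies
  on \<open>a b\<close>, each piece is contained in one of the two triangles.\<close>

lemma crossing_union_hull:
  assumes "crossing a b c d m"
  shows "convex hull {a, b, c} \<union> convex hull {a, b, d} = convex hull {a, b, c, d}"
proof
  show "convex hull {a, b, c} \<union> convex hull {a, b, d} \<subseteq> convex hull {a, b, c, d}"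
    by (intro Un_least hull_mono) auto
  note m = crossing_in_segments[OF assms]
  have mem: "m \<in> convex hull {a, b, x}" for x
    using m(1) hull_mono[of "{a, b}" "{a, b, x}"] unfolding segment_convex_hull by auto
  have "convex hull {a, b, c, d} \<subseteq> convex hull {c, m, a, b} \<union> convex hull {m, d, a, b}"
    using convex_hull_split[OF _ m(2), of "{a, b}"] by (simp add: insert_commute)
  also have "convex hull {c, m, a, b} \<subseteq> convex hull {a, b, c}"
    using mem[of c] by (intro hull_minimal) (auto simp: hull_inc)
  also have "convex hull {m, d, a, b} \<subseteq> convex hull {a, b, d}"
    using mem[of d] by (intro hull_minimal) (auto simp: hull_inc)
  finally show "convex hull {a, b, c, d} \<subseteq> convex hull {a, b, c} \<union> convex hull {a, b, d}"
    by blast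
qed

lemma crossing_union_flip:
  assumes "crossing a b c d m"
  shows "convex hull {c, d, a} \<union> convex hull {c, d, b} = convex hull {a, b, c} \<union> convex hull {a, b, d}"
proof -
  have "{c, d, a, b} = {a, b, c, d}" by auto
  then show ?thesis
    unfolding crossing_union_hull[OF assms] crossing_union_hull[OF crossing_sym(3)[OF assms]] by simp
qed

text \<open>The point \<open>a + w\<close> is an affine combination of the vertices, so its inner
  product with \<open>w\<close> is again \<open>k\<close>; hence
  \<open>w \<bullet> w = 0\<close>.\<close>

lemma constant_on_triangle_imp_zero:
  assumes "orient a b c \<noteq> 0" "w \<bullet> a = k" "w \<bullet> b = k" "w \<bullet> c = k"
  shows "w = 0"
proof -
  obtain x y z where xyz: "x + y + z = 1" "a + w = x *\<^sub>R a + y *\<^sub>R b + z *\<^sub>R c"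
    using barycentric_coordinates[OF assms(1), of "a + w"] by blast
  have "k + w \<bullet> w = w \<bullet> (a + w)" using assms(2) by (simp add: inner_add_right)
  also have "\<dots> = (x + y + z) * k"
    unfolding xyz(2) using assms(2-4) by (simp add: inner_add_right algebra_simps)
  finally show ?thesis using xyz(1) by simp
qed

text \<open>A hyperplane supporting the quadrilateral at \<open>x\<close> would contain \<open>c\<close> and \<open>d\<close>, hence \<open>m\<close>, hence
  \<open>a\<close> and \<open>b\<close>.\<close>

lemma crossing_interior:
  assumes "crossing a b c d m" "x \<in> convex hull {c, d, a}"
    "x \<notin> convex hull {a, c}" "x \<notin> convex hull {a, d}"
  shows "x \<in> interior (convex hull {a, b, c} \<union> convex hull {a, b, d})"
proof (rule ccontr)
  assume nin: "x \<notin> interior (convex hull {a, b, c} \<union> convex hull {a, b, d})"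
  define Q where "Q = convex hull {a, b, c, d}"
  have o: "orient a b c \<noteq> 0" using assms(1) by (simp add: crossing_def)
  have "interior (convex hull {a, b, c}) \<subseteq> interior Q"
    unfolding Q_def by (intro interior_mono hull_mono) auto
  then have "interior Q \<noteq> {}"
    using interior_simplex_2_nonempty[OF triangle_simplex(1)[OF o]] by blast
  then have nin: "x \<notin> rel_interior Q"
    using nin unfolding crossing_union_hull[OF assms(1)] Q_def by (simp add: rel_interior_nonempty_interior)
  have "x \<in> Q" using assms(2) hull_mono[of "{c, d, a}" "{a, b, c, d}"] unfolding Q_def by auto
  then obtain w where w: "w \<noteq> 0" "\<And>y. y \<in> Q \<Longrightarrow> w \<bullet> x \<le> w \<bullet> y"
    using supporting_hyperplane_rel_boundary[OF _ _ nin] unfolding Q_def by (metis convex_convex_hull)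
  have le: "w \<bullet> x \<le> w \<bullet> a" "w \<bullet> x \<le> w \<bullet> b" "w \<bullet> x \<le> w \<bullet> c" "w \<bullet> x \<le> w \<bullet> d"
    by (auto intro!: w(2) simp: Q_def hull_inc)
  obtain p q r where pqr: "0 \<le> p" "0 \<le> q" "0 \<le> r" "p + q + r = 1" "x = p *\<^sub>R c + q *\<^sub>R d + r *\<^sub>R a"
    using assms(2) unfolding convex_hull_3 by blast
  \<comment> \<open>As \<open>x\<close> avoids the sides \<open>a d\<close> and \<open>a c\<close>,
    its weights at \<open>c\<close> and at \<open>d\<close> are both positive.\<close>
  have "p \<noteq> 0"
  proof
    assume "p = 0"
    then have "x = r *\<^sub>R a + q *\<^sub>R d" "r + q = 1" using pqr by simp_all
    then show False using assms(4) pqr unfolding convex_hull_2 by blast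
  qed
  moreover have "q \<noteq> 0"
  proof
    assume "q = 0"
    then have "x = r *\<^sub>R a + p *\<^sub>R c" "r + p = 1" using pqr by simp_all
    then show False using assms(3) pqr unfolding convex_hull_2 by blast
  qed
  ultimately have pq: "p > 0" "q > 0" using pqr by simp_all
  \<comment> \<open>A positive combination of values at least \<open>k\<close> can only be as small
    as the same combination of \<open>k\<close> if both values equal \<open>k\<close>. This is used
    at \<open>x\<close> for \<open>c\<close>, \<open>d\<close> and at \<open>m\<close> for
    \<open>a\<close>, \<open>b\<close>.\<close>
  have convex_eq: "f = k \<and> g = k" if "0 < u" "0 < v" "k \<le> f" "k \<le> g" "u * f + v * g \<le> (u + v) * k" for u v f g k :: real
  proof -
    have "u * (f - k) + v * (g - k) \<le> 0" using that(5) by (simp add: algebra_simps)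
    moreover have "u * (f - k) \<ge> 0" "v * (g - k) \<ge> 0" using that by simp_all
    ultimately have "u * (f - k) = 0" "v * (g - k) = 0" by linarith+
    then show ?thesis using that by simp
  qed
  have "p * (w \<bullet> c) + q * (w \<bullet> d) + r * (w \<bullet> a) = (p + q + r) * (w \<bullet> x)"
    using pqr(4,5) by (simp add: inner_add_right)
  moreover have "r * (w \<bullet> x) \<le> r * (w \<bullet> a)" using pqr le by (intro mult_left_mono) auto
  ultimately have cd: "w \<bullet> c = w \<bullet> x \<and> w \<bullet> d = w \<bullet> x"
    using pq le by (intro convex_eq[of p q]) (auto simp: algebra_simps)
  obtain \<alpha> \<tau> where m: "0 < \<alpha>" "\<alpha> < 1"
    "m = (1 - \<alpha>) *\<^sub>R a + \<alpha> *\<^sub>R b" "m = (1 - \<tau>) *\<^sub>R c + \<tau> *\<^sub>R d"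
    using crossing_param[OF assms(1)] by metis
  have "w \<bullet> m = w \<bullet> x" unfolding m(4) using cd by (simp add: inner_add_right algebra_simps)
  then have ab: "w \<bullet> a = w \<bullet> x \<and> w \<bullet> b = w \<bullet> x"
    using m(1,2) le by (intro convex_eq[of "1 - \<alpha>" \<alpha>]) (auto simp: m(3) inner_add_right)
  show False using constant_on_triangle_imp_zero[OF o] ab cd w(1) by blast
qed

lemma edge_face_of_triangle:
  assumes "orient a b c \<noteq> 0" "e \<subseteq> {a, b, c}"
  shows "convex hull e face_of convex hull {a, b, c}"
  using assms(2) face_of_convex_hull_affine_independent[OF orient_nonzero_imp_independent[OF assms(1)]]
  by blast

text \<open>If neither face contained the other, a segment between the two differences would lie in the
  union; any of its interior points in one face would pull both endpoints into that face.\<close>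

lemma faces_convex_union:
  assumes "F face_of U" "G face_of U" "convex (F \<union> G)"
  shows "F \<subseteq> G \<or> G \<subseteq> F"
proof (rule ccontr)
  assume "\<not> (F \<subseteq> G \<or> G \<subseteq> F)"
  then obtain x y where x: "x \<in> F" "x \<notin> G" and y: "y \<in> G" "y \<notin> F" by blast
  then have "open_segment x y \<noteq> {}" by auto
  then obtain z where z: "z \<in> open_segment x y" by blast
  then have "z \<in> closed_segment x y" using segment_open_subset_closed by blast
  then have "z \<in> F \<union> G" using assms(3) x y by (metis UnI1 UnI2 convex_contains_segment subsetD)
  moreover have "x \<in> U" "y \<in> U" using x y assms face_of_imp_subset by blast+
  ultimately show False using z x y assms(1,2) face_ofD by blast
qed

text \<open>Since the triangles differ, the intersection is a proper face of at least one of
  them.\<close>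

lemma interior_disjoint_simplex_2:
  fixes X :: "point set"
  assumes "2 simplex X" "2 simplex T" "X \<inter> T face_of X" "X \<inter> T face_of T" "X \<noteq> T"
  shows "interior (X \<inter> T) = {}"
proof (cases "X \<inter> T = T")
  case True
  then have "T face_of X" "T \<noteq> X" using assms by auto
  then show ?thesis using True interior_proper_face_empty[OF convex_simplex[OF assms(1)]] by simp
next
  case False
  then show ?thesis using interior_proper_face_empty[OF convex_simplex[OF assms(2)] assms(4)] by simp
qed

text \<open>\<open>X\<close> is the closure of its interior, so if it met the open set, its interior
  would too. That overlap is the interior of a union of two closed sets with empty interior.\<close>

lemma disjoint_interior_union:
  fixes X :: "point set"
  assumes "2 simplex X" "closed T" "closed T'" "interior (X \<inter> T) = {}" "interior (X \<inter> T') = {}"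
  shows "X \<inter> interior (T \<union> T') = {}"
proof (rule ccontr)
  assume "X \<inter> interior (T \<union> T') \<noteq> {}"
  moreover have "X = closure (interior X)"
    using convex_closure_interior[OF convex_simplex interior_simplex_2_nonempty] assms(1) closed_simplex
    by (metis closure_closed)
  ultimately have "interior X \<inter> interior (T \<union> T') \<noteq> {}"
    by (metis Int_commute open_Int_closure_eq_empty open_interior)
  moreover have "interior X \<inter> interior (T \<union> T') = interior ((X \<inter> T) \<union> (X \<inter> T'))"
    by (simp flip: interior_Int Int_Un_distrib)
  moreover have "\<dots> = {}"
    unfolding interior_closed_Un_empty_interior[OF closed_Int[OF closed_simplex[OF assms(1)] assms(2)] assms(5)]
    by (rule assms(4))
  ultimately show False by simp
qed

text \<open>Since \<open>X\<close> misses the interior of the quadrilateral, it meets \<open>U\<close> only along the two outer edges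
  \<open>a c\<close> and \<open>a d\<close>, in faces whose union is convex.\<close>

lemma flip_face:
  assumes "crossing a b c d m" "2 simplex X"
    and T: "T = convex hull {a, b, c}" "X \<inter> T face_of X" "X \<inter> T face_of T" "X \<noteq> T"
    and T': "T' = convex hull {a, b, d}" "X \<inter> T' face_of X" "X \<inter> T' face_of T'" "X \<noteq> T'"
    and U: "U = convex hull {c, d, a}"
  shows "X \<inter> U face_of X \<and> X \<inter> U face_of U"
proof -
  have o: "orient a b c \<noteq> 0" "orient a b d \<noteq> 0" "orient c d a \<noteq> 0"
    using crossing_sym[OF assms(1)] assms(1) by (simp_all add: crossing_def)
  have s: "2 simplex T" "2 simplex T'" using o triangle_simplex T(1) T'(1) by auto
  have disj: "X \<inter> interior (T \<union> T') = {}"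
    using s T T' assms(2) by (intro disjoint_interior_union interior_disjoint_simplex_2) (auto intro: closed_simplex)
  define F where "F = X \<inter> convex hull {a, c}"
  define G where "G = X \<inter> convex hull {a, d}"
  have sub: "convex hull {a, c} \<subseteq> U" "convex hull {a, d} \<subseteq> U" unfolding U by (intro hull_mono; auto)+
  have FG: "X \<inter> U = F \<union> G"
    using sub crossing_interior[OF assms(1)] disj unfolding F_def G_def U T(1) T'(1) by blast
  \<comment> \<open>Faces are carried from an old triangle \<open>V\<close> to \<open>U\<close>
    across a common edge \<open>e\<close>: the trace of \<open>X\<close> on \<open>e\<close> is a
    face of the trace on \<open>V\<close>, hence of \<open>X\<close>, and a face of
    \<open>e\<close>, hence of \<open>U\<close>.\<close>
  have face: "X \<inter> convex hull e face_of X \<and> X \<inter> convex hull e face_of U"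
    if "X \<inter> convex hull V face_of X" "X \<inter> convex hull V face_of convex hull V"
      "convex hull e face_of convex hull V" "convex hull e face_of U" for V e
  proof -
    have *: "X \<inter> convex hull e = (X \<inter> convex hull V) \<inter> convex hull e"
      using face_of_imp_subset[OF that(3)] by blast
    have V: "X \<inter> convex hull e face_of convex hull V"
      unfolding * by (rule face_of_Int[OF that(2,3)])
    have "X \<inter> convex hull e face_of X \<inter> convex hull V"
      by (rule face_of_subset[OF V]) (use face_of_imp_subset[OF that(3)] in auto)
    then have "X \<inter> convex hull e face_of X" using that(1) face_of_trans by blast
    moreover have "X \<inter> convex hull e face_of convex hull e"
      by (rule face_of_subset[OF V]) (use face_of_imp_subset[OF that(3)] in auto)
    ultimately show ?thesis using that(4) face_of_trans by blast
  qed
  have F: "F face_of X \<and> F face_of U"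
    unfolding F_def using T o by (intro face[of "{a, b, c}"]) (auto simp: U intro!: edge_face_of_triangle)
  have G: "G face_of X \<and> G face_of U"
    unfolding G_def using T' o by (intro face[of "{a, b, d}"]) (auto simp: U intro!: edge_face_of_triangle)
  have "convex (F \<union> G)"
    unfolding FG[symmetric] U using assms(2) by (intro convex_Int convex_simplex convex_convex_hull)
  then have "F \<subseteq> G \<or> G \<subseteq> F" using faces_convex_union F G by blast
  then have "X \<inter> U = F \<or> X \<inter> U = G" using FG by blast
  then show ?thesis using F G by metis
qed

text \<open>At a common point, \<open>orient c d\<close> is a nonnegative multiple of two numbers of
  opposite sign, so the weight at \<open>a\<close> vanishes.\<close>

lemma triangles_meet_in_edge:
  assumes "orient c d a * orient c d b < 0"
  shows "convex hull {c, d, a} \<inter> convex hull {c, d, b} = convex hull {c, d}"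
proof
  show "convex hull {c, d} \<subseteq> convex hull {c, d, a} \<inter> convex hull {c, d, b}"
    by (intro Int_greatest hull_mono) auto
  show "convex hull {c, d, a} \<inter> convex hull {c, d, b} \<subseteq> convex hull {c, d}"
  proof
    fix x assume "x \<in> convex hull {c, d, a} \<inter> convex hull {c, d, b}"
    then obtain u v w u' v' w' where x: "0 \<le> u" "0 \<le> v" "0 \<le> w" "u + v + w = 1" "x = u *\<^sub>R c + v *\<^sub>R d + w *\<^sub>R a"
      "0 \<le> u'" "0 \<le> v'" "0 \<le> w'" "u' + v' + w' = 1" "x = u' *\<^sub>R c + v' *\<^sub>R d + w' *\<^sub>R b"
      unfolding convex_hull_3 by blast
    have "orient c d x = w * orient c d a" unfolding x(5) orient_affine[OF x(4)] by simp
    moreover have "orient c d x = w' * orient c d b" unfolding x(10) orient_affine[OF x(9)] by simp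
    ultimately have eq: "w * orient c d a = w' * orient c d b" by simp
    have "w = 0"
    proof (rule ccontr)
      assume "w \<noteq> 0"
      then have "0 < w * (orient c d a)\<^sup>2" using assms x by (auto simp: zero_less_mult_iff)
      also have "\<dots> = w' * (orient c d a * orient c d b)"
        using eq by (simp add: power2_eq_square algebra_simps)
      also have "\<dots> \<le> 0" by (rule mult_nonneg_nonpos[OF x(8)]) (use assms in simp)
      finally show False by simp
    qed
    then show "x \<in> convex hull {c, d}" unfolding convex_hull_2 using x by auto
  qed
qed

lemma triangulation_ofD:
  assumes "triangulation_of S t"
  shows "finite t" "\<And>T. T \<in> t \<Longrightarrow> 2 simplex T" "\<Union>t = convex hull S" "(\<Union>T\<in>t. vertices T) = S"
    "\<And>T X. T \<in> t \<Longrightarrow> X \<in> t \<Longrightarrow> T \<inter> X face_of T" "\<And>T X. T \<in> t \<Longrightarrow> X \<in> t \<Longrightarrow> T \<inter> X face_of X"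
  using assms unfolding triangulation_of_def triangulation_def by (blast, blast, blast, blast, blast, metis Int_commute)

text \<open>Both pairs of triangles have the same union and together the same vertices, so the work
  lies in the face conditions: \<open>flip_face\<close> for an old and a new triangle, the diagonal
  \<open>c d\<close> for the two new ones.\<close>

lemma flip_triangulation:
  assumes t: "triangulation_of S t" and cr: "crossing a b c d m"
    and mem: "convex hull {a, b, c} \<in> t" "convex hull {a, b, d} \<in> t"
  shows "triangulation_of S (t - {convex hull {a, b, c}, convex hull {a, b, d}}
      \<union> {convex hull {c, d, a}, convex hull {c, d, b}})"
proof -
  define T where "T = convex hull {a, b, c}"
  define T' where "T' = convex hull {a, b, d}"
  define U where "U = convex hull {c, d, a}"
  define U' where "U' = convex hull {c, d, b}"
  note D = triangulation_ofD[OF t]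
  have mem': "T \<in> t" "T' \<in> t" using mem by (simp_all add: T_def T'_def)
  have o: "orient a b c \<noteq> 0" "orient a b d \<noteq> 0" "orient c d a \<noteq> 0" "orient c d b \<noteq> 0"
    using crossing_sym[OF cr] crossing_sym(2)[OF crossing_sym(3)[OF cr]] cr
    by (simp_all add: crossing_def)
  have simplex: "2 simplex U" "2 simplex U'"
    using o triangle_simplex(1) by (simp_all add: U_def U'_def)
  have vert: "vertices T = {a, b, c}" "vertices T' = {a, b, d}" "vertices U = {c, d, a}" "vertices U' = {c, d, b}"
    using o triangle_simplex(2) by (simp_all add: T_def T'_def U_def U'_def)
  have faces: "X \<inter> U face_of X \<and> X \<inter> U face_of U" "X \<inter> U' face_of X \<and> X \<inter> U' face_of U'"
    if X: "X \<in> t" "X \<noteq> T" "X \<noteq> T'" for X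
  proof -
    show "X \<inter> U face_of X \<and> X \<inter> U face_of U"
      by (rule flip_face[OF cr D(2)[OF X(1)] T_def D(5)[OF X(1) mem'(1)] D(6)[OF X(1) mem'(1)] X(2)
            T'_def D(5)[OF X(1) mem'(2)] D(6)[OF X(1) mem'(2)] X(3) U_def])
    \<comment> \<open>Exchanging \<open>a\<close> and \<open>b\<close> reduces the triangle at
      \<open>b\<close> to the one at \<open>a\<close>.\<close>
    have "T = convex hull {b, a, c}" "T' = convex hull {b, a, d}"
      by (simp_all add: T_def T'_def insert_commute)
    then show "X \<inter> U' face_of X \<and> X \<inter> U' face_of U'"
      by (intro flip_face[OF crossing_sym(1)[OF cr] D(2)[OF X(1)] _ D(5)[OF X(1) mem'(1)] D(6)[OF X(1) mem'(1)] X(2)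
            _ D(5)[OF X(1) mem'(2)] D(6)[OF X(1) mem'(2)] X(3) U'_def])
  qed
  have "orient c d a * orient c d b < 0"
  proof -
    obtain \<alpha> s where p: "0 < \<alpha>" "\<alpha> < 1" "s \<noteq> 0" "orient c d a = \<alpha> * s" "orient c d b = - (1 - \<alpha>) * s"
      using crossing_param[OF cr] by metis
    have "orient c d a * orient c d b = - (\<alpha> * (1 - \<alpha>) * s\<^sup>2)"
      unfolding p(4,5) by (simp add: power2_eq_square algebra_simps)
    then show ?thesis using p by simp
  qed
  then have UU': "U \<inter> U' = convex hull {c, d}" unfolding U_def U'_def by (rule triangles_meet_in_edge)
  then have UU'_face: "U \<inter> U' face_of U" "U \<inter> U' face_of U'"
    unfolding UU' U_def U'_def using o by (auto intro: edge_face_of_triangle)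
  have self: "U \<inter> U face_of U" "U' \<inter> U' face_of U'"
    using simplex convex_simplex by (auto intro: face_of_refl)
  have "\<Union>(t - {T, T'} \<union> {U, U'}) = \<Union>(t - {T, T'}) \<union> (U \<union> U')" by auto
  also have "U \<union> U' = T \<union> T'" unfolding U_def U'_def T_def T'_def by (rule crossing_union_flip[OF cr])
  also have "\<Union>(t - {T, T'}) \<union> (T \<union> T') = \<Union>t" using mem' by blast
  finally have un: "\<Union>(t - {T, T'} \<union> {U, U'}) = convex hull S" using D(3) by simp
  have "(\<Union>X\<in>t - {T, T'} \<union> {U, U'}. vertices X) = (\<Union>X\<in>t - {T, T'}. vertices X) \<union> (vertices U \<union> vertices U')"
    by auto
  also have "vertices U \<union> vertices U' = vertices T \<union> vertices T'" unfolding vert by auto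
  also have "(\<Union>X\<in>t - {T, T'}. vertices X) \<union> (vertices T \<union> vertices T') = S" using mem' D(4) by blast
  finally have ve: "(\<Union>X\<in>t - {T, T'} \<union> {U, U'}. vertices X) = S" .
  have fc: "X \<inter> Y face_of X" if "X \<in> t - {T, T'} \<union> {U, U'}" "Y \<in> t - {T, T'} \<union> {U, U'}" for X Y
  proof -
    have "X \<in> t \<and> X \<noteq> T \<and> X \<noteq> T' \<or> X = U \<or> X = U'" "Y \<in> t \<and> Y \<noteq> T \<and> Y \<noteq> T' \<or> Y = U \<or> Y = U'"
      using that by blast+
    then show ?thesis
      using UU'_face self by (elim disjE) (use faces[of X] faces[of Y] D(5)[of X Y] in \<open>simp_all add: Int_commute\<close>)
  qed
  have "triangulation_of S (t - {T, T'} \<union> {U, U'})"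
    unfolding triangulation_of_def triangulation_def using D(1,2) simplex un ve fc by blast
  then show ?thesis unfolding T_def T'_def U_def U'_def .
qed

lemma flip_improves:
  assumes t: "triangulation_of S t" and cr: "crossing a b c d m"
    and mem: "convex hull {a, b, c} \<in> t" "convex hull {a, b, d} \<in> t"
    and circ: "{a, b, c} \<subseteq> sphere z r" "d \<in> ball z r"
  obtains t' where "triangulation_of S t'" "hrm t' < hrm t"
proof
  let ?T = "convex hull {a, b, c}" and ?T' = "convex hull {a, b, d}"
  let ?U = "convex hull {c, d, a}" and ?U' = "convex hull {c, d, b}"
  show "triangulation_of S (t - {?T, ?T'} \<union> {?U, ?U'})" by (rule flip_triangulation[OF t cr mem])
  have fin: "finite t" using triangulation_ofD(1)[OF t] .
  \<comment> \<open>The old triangles must differ for both of their terms to leave the sum.\<close>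
  have ne: "?T \<noteq> ?T'"
  proof
    assume eq: "?T = ?T'"
    have "orient a b c \<noteq> 0" "orient a b d \<noteq> 0"
      using cr crossing_sym(2)[OF cr] unfolding crossing_def by blast+
    from this[THEN triangle_simplex(2)] have "{a, b, c} = {a, b, d}" unfolding eq by argo
    then have "d \<in> {a, b, c}" by blast
    then show False using circ by auto
  qed
  \<comment> \<open>Nonnegativity of \<open>hrm_triangle\<close> gives upper bounds that hold
    whether or not the new triangles coincide with each other or with remaining ones.\<close>
  have "hrm (t - {?T, ?T'} \<union> {?U, ?U'}) \<le> hrm (t - {?T, ?T'}) + hrm {?U, ?U'}"
    unfolding hrm_def using fin hrm_triangle_nonneg by (subst sum_Un) (auto simp: sum_nonneg)
  also have "hrm {?U, ?U'} \<le> hrm_triangle ?U + hrm_triangle ?U'"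
    unfolding hrm_def using hrm_triangle_nonneg by (cases "?U = ?U'") auto
  also have "\<dots> < hrm_triangle ?T + hrm_triangle ?T'"
    by (rule flip_decreases_hrm[OF cr circ])
  also have "hrm (t - {?T, ?T'}) + (hrm_triangle ?T + hrm_triangle ?T') = hrm t"
    unfolding hrm_def using fin mem ne sum.subset_diff[of "{?T, ?T'}" t hrm_triangle] by simp
  finally show "hrm (t - {?T, ?T'} \<union> {?U, ?U'}) < hrm t" by simp
qed

section \<open>Locally Delaunay edges\<close>

text \<open>Extreme points pass to a face containing them, and from a face to the whole. Thus no
  vertex lies in another triangle without being a vertex there.\<close>

lemma vertices_transfer:
  assumes "triangulation_of S t" "X \<in> t" "Y \<in> t" "p \<in> vertices X" "p \<in> Y"
  shows "p \<in> vertices Y"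
proof -
  have "p extreme_point_of X" using assms(4) by (simp add: vertices_def)
  moreover from this have "p \<in> X" by (simp add: extreme_point_of_def)
  ultimately have "p extreme_point_of (X \<inter> Y)"
    using extreme_point_of_face[OF triangulation_ofD(5)[OF assms(1-3)]] assms(5) by blast
  then show ?thesis
    using extreme_point_of_face[OF triangulation_ofD(6)[OF assms(1-3)]] by (simp add: vertices_def)
qed

text \<open>Otherwise all three barycentric coordinates of \<open>p\<close> would be
  nonnegative.\<close>

lemma separating_edge:
  assumes "orient a b c \<noteq> 0" "p \<notin> convex hull {a, b, c}"
  obtains a' b' c' where "{a', b', c'} = {a, b, c}" "orient a' b' p * orient a' b' c' < 0"
proof -
  let ?o = "orient a b c"
  have "\<not> (0 \<le> orient p b c * ?o \<and> 0 \<le> orient a p c * ?o \<and> 0 \<le> orient a b p * ?o)"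
  proof
    assume nn: "0 \<le> orient p b c * ?o \<and> 0 \<le> orient a p c * ?o \<and> 0 \<le> orient a b p * ?o"
    have div: "0 \<le> x / ?o" if "0 \<le> x * ?o" for x
      using that assms(1) by (auto simp: zero_le_mult_iff zero_le_divide_iff)
    have "p \<in> convex hull {a, b, c}"
      unfolding convex_hull_3 using nn div barycentric_coordinates[OF assms(1), of p] by blast
    with assms(2) show False ..
  qed
  then consider "orient p b c * ?o < 0" | "orient a p c * ?o < 0" | "orient a b p * ?o < 0"
    by linarith
  then show ?thesis
  proof cases
    case 1
    then have "orient b c p * orient b c a < 0"
      unfolding orient_rotate(1)[of b c p] orient_rotate(1)[of b c a] .
    moreover have "{b, c, a} = {a, b, c}" by auto
    ultimately show ?thesis using that by metis
  next
    case 2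
    then have "orient c a p * orient c a b < 0"
      unfolding orient_rotate(2)[of c a p] orient_rotate(2)[of c a b] .
    moreover have "{c, a, b} = {a, b, c}" by auto
    ultimately show ?thesis using that by metis
  next
    case 3
    then show ?thesis using that[of a b c] by simp
  qed
qed

text \<open>The segment \<open>c d\<close> meets the line \<open>a b\<close> at some
  \<open>m\<close>, which has negative power because \<open>d\<close> does. On the line of a chord
  this happens only strictly between its endpoints.\<close>

lemma crossing_exists:
  assumes "orient a b c * orient a b d < 0" "{a, b, c} \<subseteq> sphere z r" "d \<in> ball z r"
  obtains m where "crossing a b c d m"
proof -
  \<comment> \<open>The zero of the affine function \<open>orient a b\<close> along the segment from
    \<open>c\<close> to \<open>d\<close>.\<close>
  define \<tau> where "\<tau> = orient a b c / (orient a b c - orient a b d)"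
  have ne: "orient a b c \<noteq> 0" using assms by auto
  have \<tau>: "0 < \<tau>" "\<tau> < 1"
    using assms(1) by (auto simp: \<tau>_def mult_less_0_iff divide_simps)
  define m where "m = (1 - \<tau>) *\<^sub>R c + \<tau> *\<^sub>R d"
  have "orient a b m = (1 - \<tau>) * orient a b c + \<tau> * orient a b d"
    using orient_affine[of 0 "1 - \<tau>" \<tau> a b a c d] by (simp add: m_def)
  also have "\<dots> = orient a b c - \<tau> * (orient a b c - orient a b d)" by (simp add: algebra_simps)
  also have "\<dots> = 0" using assms(1) by (auto simp: \<tau>_def mult_less_0_iff)
  finally obtain s where s: "m = (1 - s) *\<^sub>R a + s *\<^sub>R b"
    using orient_eq_0_imp_on_line orient_nonzero_distinct(1)[OF ne] by metis
  have "(dist z m)\<^sup>2 = r\<^sup>2 - s * (1 - s) * (dist a b)\<^sup>2"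
    unfolding s power_combination using assms(2) by (simp add: algebra_simps)
  moreover have "(dist z m)\<^sup>2 < r\<^sup>2"
  proof -
    have "(dist z d)\<^sup>2 < r\<^sup>2" using assms(3) by (auto intro: power_strict_mono)
    then have "\<tau> * (dist z d)\<^sup>2 < \<tau> * r\<^sup>2" using \<tau> by simp
    moreover have "(1 - \<tau>) * (dist z c)\<^sup>2 = (1 - \<tau>) * r\<^sup>2" using assms(2) by simp
    moreover have "0 \<le> \<tau> * (1 - \<tau>) * (dist c d)\<^sup>2" using \<tau> by simp
    ultimately show ?thesis unfolding m_def power_combination by (simp add: algebra_simps)
  qed
  ultimately have "0 < s * (1 - s) * (dist a b)\<^sup>2" by linarith
  then have "0 < s" "s < 1" by (auto simp: zero_less_mult_iff)
  moreover have "c \<noteq> d" using assms by auto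
  ultimately have "crossing a b c d m"
    unfolding crossing_def in_segment
    using ne orient_nonzero_distinct(1)[OF ne] s \<tau> m_def by blast
  then show ?thesis by (rule that)
qed

text \<open>The quadratic terms in \<open>x\<close> cancel.\<close>

lemma power_difference_affine:
  fixes z w :: "'a::real_inner"
  shows "(dist z x)\<^sup>2 - (dist w x)\<^sup>2 = 2 * ((w - z) \<bullet> x) + (z \<bullet> z - w \<bullet> w)"
  by (simp add: dist_norm power2_norm_eq_inner inner_diff_left inner_diff_right inner_commute algebra_simps)

lemma not_delaunay_improves:
  assumes t: "triangulation_of S t"
    and circ: "\<And>Q c r. Q \<subseteq> S \<Longrightarrow> card Q = 4 \<Longrightarrow> \<not> Q \<subseteq> sphere c r"
    and T0: "T0 \<in> t" "T0 \<notin> delaunay S"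
  obtains t' where "triangulation_of S t'" "hrm t' < hrm t"
proof -
  note D = triangulation_ofD[OF t]
  have "\<exists>z r. vertices T \<subseteq> sphere z r" if "T \<in> t" for T
    using simplex_2E[OF D(2)[OF that]] circumcircle_exists by metis
  then obtain z r where sph: "\<And>T. T \<in> t \<Longrightarrow> vertices T \<subseteq> sphere (z T) (r T)" by metis
  define P where "P T x = (dist (z T) x)\<^sup>2 - (r T)\<^sup>2" for T x
  have P0: "P T v = 0" if "T \<in> t" "v \<in> vertices T" for T v
    using sph[OF that(1)] that(2) by (auto simp: P_def)
  have r0: "r T \<ge> 0" if T: "T \<in> t" for T
  proof -
    have "vertices T \<noteq> {}" using simplex_2_vertices(2)[OF D(2)[OF T]] by auto
    then obtain v where "dist (z T) v = r T" using sph[OF T] by fastforce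
    then show ?thesis by (metis zero_le_dist)
  qed
  have verts: "vertices T \<subseteq> S" if "T \<in> t" for T using D(4) that by blast
  \<comment> \<open>The circumcircle of \<open>T0\<close> meets every other requirement for a
    Delaunay triangle, so its open disk must contain a point of \<open>S\<close>.\<close>
  obtain p where p: "p \<in> S" "p \<in> ball (z T0) (r T0)"
    using T0 D(2)[OF T0(1)] verts[OF T0(1)] sph[OF T0(1)] unfolding delaunay_def by blast
  then have "P T0 p < 0" unfolding P_def by (auto intro: power_strict_mono)
  moreover obtain T where T: "T \<in> t" "\<And>X. X \<in> t \<Longrightarrow> P T p \<le> P X p"
    using ex_is_arg_min_if_finite[OF D(1), of "\<lambda>X. P X p"] T0(1) unfolding is_arg_min_def
    by (metis empty_iff linorder_not_less)
  ultimately have neg: "P T p < 0" using T0(1) by fastforce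
  have pT: "p \<notin> T"
  proof
    assume "p \<in> T"
    moreover obtain X where "X \<in> t" "p \<in> vertices X" using p(1) D(4) by blast
    ultimately have "p \<in> vertices T" using vertices_transfer[OF t] T(1) by blast
    then show False using P0 neg T(1) by fastforce
  qed
  obtain a b c where abc: "orient a b p * orient a b c < 0" "T = convex hull {a, b, c}" "vertices T = {a, b, c}"
  proof -
    obtain a b c where 1: "orient a b c \<noteq> 0" "T = convex hull {a, b, c}" "vertices T = {a, b, c}"
      using simplex_2E[OF D(2)[OF T(1)]] by metis
    then obtain a' b' c' where "{a', b', c'} = {a, b, c}" "orient a' b' p * orient a' b' c' < 0"
      using separating_edge[OF 1(1)] pT by metis
    with 1 that show ?thesis by metis
  qed
  have ab: "a \<noteq> b" using abc(1) by auto
  \<comment> \<open>To find the neighbour across \<open>a b\<close>, start at the midpoint of the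
    edge and move slightly towards \<open>p\<close>, within a ball that avoids all triangles not
    containing the midpoint.\<close>
  define m0 where "m0 = (1 / 2) *\<^sub>R a + (1 / 2) *\<^sub>R b"
  have "closed (\<Union>{X \<in> t. m0 \<notin> X})"
    using D(1,2) by (intro closed_Union) (auto intro: closed_simplex)
  then have "open (- \<Union>{X \<in> t. m0 \<notin> X})" by (rule open_Compl)
  moreover have "m0 \<in> - \<Union>{X \<in> t. m0 \<notin> X}" by blast
  ultimately obtain e where e: "e > 0" "ball m0 e \<subseteq> - \<Union>{X \<in> t. m0 \<notin> X}" by (meson openE)
  \<comment> \<open>With this value \<open>y\<close> has distance less than \<open>e\<close> from
    \<open>m0\<close>, without bounding the distance to \<open>p\<close>.\<close>
  define \<epsilon> where "\<epsilon> = e / (e + dist m0 p)"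
  have eD: "e + dist m0 p > 0" using e(1) by (simp add: add_pos_nonneg)
  have \<epsilon>: "0 < \<epsilon>" "\<epsilon> \<le> 1" using e(1) eD by (simp_all add: \<epsilon>_def)
  define y where "y = (1 - \<epsilon>) *\<^sub>R m0 + \<epsilon> *\<^sub>R p"
  have "dist m0 y = \<epsilon> * dist m0 p"
  proof -
    have "m0 - y = \<epsilon> *\<^sub>R (m0 - p)" by (simp add: y_def algebra_simps)
    then show ?thesis using \<epsilon> by (simp add: dist_norm)
  qed
  also have "\<dots> < e" using e(1) eD by (simp add: \<epsilon>_def field_simps)
  finally have y_ball: "y \<in> ball m0 e" by simp
  have abS: "a \<in> S" "b \<in> S" "c \<in> S" using verts[OF T(1)] abc(3) by auto
  have "m0 \<in> convex hull S"
    unfolding m0_def using abS by (intro convexD[OF convex_convex_hull]) (auto simp: hull_inc)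
  then have "y \<in> \<Union>t"
    unfolding D(3) y_def using p(1) \<epsilon> by (intro convexD[OF convex_convex_hull]) (auto simp: hull_inc)
  then obtain X where X: "X \<in> t" "y \<in> X" by blast
  then have m0X: "m0 \<in> X" using y_ball e(2) by blast
  have m0seg: "m0 \<in> open_segment a b"
    unfolding in_segment using ab by (auto simp: m0_def intro!: exI[of _ "1/2"])
  have aT: "a \<in> T" "b \<in> T" unfolding abc(2) by (simp_all add: hull_inc)
  have "m0 \<in> T"
    using m0seg segment_open_subset_closed closed_segment_subset[OF aT] convex_simplex[OF D(2)[OF T(1)]] by blast
  \<comment> \<open>A face containing an inner point of the segment \<open>a b\<close> contains both
    endpoints.\<close>
  then have "a \<in> T \<inter> X \<and> b \<in> T \<inter> X"
    using face_ofD[OF D(5)[OF T(1) X(1)] m0seg aT] m0X by blast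
  then have "a \<in> vertices X" "b \<in> vertices X"
    using vertices_transfer[OF t T(1) X(1)] abc(3) by auto
  then obtain d where d: "orient a b d \<noteq> 0" "X = convex hull {a, b, d}" "vertices X = {a, b, d}"
    using simplex_2_with_vertices[OF D(2)[OF X(1)] _ _ ab] by metis
  obtain u v w where uvw: "0 \<le> u" "0 \<le> v" "0 \<le> w" "u + v + w = 1" "y = u *\<^sub>R a + v *\<^sub>R b + w *\<^sub>R d"
    using X(2) unfolding d(2) convex_hull_3 by blast
  \<comment> \<open>Evaluating \<open>orient a b y\<close> in the triangle \<open>X\<close> and on
    the segment from \<open>m0\<close> to \<open>p\<close> shows that \<open>d\<close> lies on the
    side of \<open>p\<close>.\<close>
  have "w * orient a b d = orient a b y" unfolding uvw(5) orient_affine[OF uvw(4)] by simp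
  also have "y = ((1 - \<epsilon>) / 2) *\<^sub>R a + ((1 - \<epsilon>) / 2) *\<^sub>R b + \<epsilon> *\<^sub>R p"
    by (simp add: y_def m0_def algebra_simps)
  also have "orient a b \<dots> = \<epsilon> * orient a b p" by (subst orient_affine) (simp_all add: field_simps)
  finally have wd: "w * orient a b d = \<epsilon> * orient a b p" .
  have pd: "0 < orient a b p * orient a b d"
  proof -
    have "0 < \<epsilon> * (orient a b p)\<^sup>2" using \<epsilon> abc(1) by (auto simp: zero_less_mult_iff)
    also have "\<dots> = w * (orient a b p * orient a b d)" using wd by (simp add: power2_eq_square algebra_simps)
    finally show ?thesis using uvw(3) by (simp add: zero_less_mult_iff)
  qed
  have cd: "orient a b c * orient a b d < 0"
    using abc(1) pd by (auto simp: mult_less_0_iff zero_less_mult_iff)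
  have "P T d < 0"
  proof (rule ccontr)
    assume "\<not> P T d < 0"
    moreover have "P T d \<noteq> 0"
    proof
      assume "P T d = 0"
      moreover have "d \<in> S" using verts[OF X(1)] d(3) by auto
      ultimately have "{a, b, c, d} \<subseteq> S" "{a, b, c, d} \<subseteq> sphere (z T) (r T)"
        using sph[OF T(1)] r0[OF T(1)] abc(3) abS by (auto simp: P_def power2_eq_iff_nonneg)
      moreover have "distinct [a, b, c, d]" using ab cd by auto
      then have "card {a, b, c, d} = 4" using distinct_card by fastforce
      ultimately show False using circ by blast
    qed
    ultimately have Pd: "P T d > 0" by simp
    \<comment> \<open>\<open>P T - P X\<close> is affine, vanishes at \<open>a\<close> and
      \<open>b\<close> and is positive at \<open>d\<close>, so it is positive at \<open>p\<close>,
      contradicting the choice of \<open>T\<close>.\<close>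
    obtain u v w where bary: "u + v + w = 1" "p = u *\<^sub>R a + v *\<^sub>R b + w *\<^sub>R d"
      using barycentric_coordinates[OF d(1), of p] by blast
    have "orient a b p = w * orient a b d" unfolding bary(2) orient_affine[OF bary(1)] by simp
    then have "w * (orient a b d)\<^sup>2 > 0" using pd by (simp add: power2_eq_square algebra_simps)
    then have w: "w > 0" by (simp add: zero_less_mult_iff)
    define g where "g = z X - z T"
    define k where "k = z T \<bullet> z T - z X \<bullet> z X - (r T)\<^sup>2 + (r X)\<^sup>2"
    have diff: "P T x - P X x = 2 * (g \<bullet> x) + k" for x
      using power_difference_affine[of "z T" x "z X"] by (simp add: P_def g_def k_def)
    have "2 * (g \<bullet> a) + k = 0" "2 * (g \<bullet> b) + k = 0" "2 * (g \<bullet> d) + k = P T d"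
      using diff[of a] diff[of b] diff[of d] P0 T(1) X(1) abc(3) d(3) by simp_all
    moreover have "2 * (g \<bullet> p) + k = u * (2 * (g \<bullet> a) + k) + v * (2 * (g \<bullet> b) + k) + w * (2 * (g \<bullet> d) + k)"
    proof -
      have u: "u = 1 - v - w" using bary(1) by simp
      show ?thesis unfolding bary(2) u by (simp add: inner_add_right algebra_simps)
    qed
    ultimately have "P T p - P X p = w * P T d" using diff[of p] by simp
    then have "P X p < P T p" using w Pd by (metis diff_gt_0_iff_gt mult_pos_pos)
    then show False using T(2)[OF X(1)] by simp
  qed
  then have dball: "d \<in> ball (z T) (r T)"
    using r0[OF T(1)] by (simp add: P_def power_less_imp_less_base)
  have csph: "{a, b, c} \<subseteq> sphere (z T) (r T)" using sph[OF T(1)] abc(3) by simp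
  obtain m where "crossing a b c d m" using crossing_exists[OF cd csph dball] .
  then show ?thesis using flip_improves[OF t _ _ _ csph dball] that T(1) X(1) abc(2) d(2) by metis
qed

section \<open>Uniqueness and existence of the minimizer\<close>

text \<open>Let \<open>X\<close> in \<open>t\<close> overlap the Delaunay triangle \<open>T\<close>.
  As both disks are empty, the power for \<open>T\<close> minus the power for \<open>X\<close> is at
  most 0 on \<open>T\<close> and at least 0 on \<open>X\<close>. It therefore vanishes on an open
  set, so the circles agree.\<close>

lemma delaunay_subset:
  assumes t: "triangulation_of S t"
    and circ: "\<And>Q c r. Q \<subseteq> S \<Longrightarrow> card Q = 4 \<Longrightarrow> \<not> Q \<subseteq> sphere c r"
    and sub: "t \<subseteq> delaunay S"
  shows "delaunay S \<subseteq> t"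
proof
  fix T assume T: "T \<in> delaunay S"
  note D = triangulation_ofD[OF t]
  obtain z r where zr: "2 simplex T" "vertices T \<subseteq> S" "vertices T \<subseteq> sphere z r" "ball z r \<inter> S = {}"
    using T unfolding delaunay_def by blast
  have "T \<subseteq> \<Union>t" unfolding D(3) by (subst simplex_2_vertices(4)[OF zr(1)]) (rule hull_mono[OF zr(2)])
  then obtain X where X: "X \<in> t" "interior (T \<inter> X) \<noteq> {}"
    using interior_meets_member[of t T] D(1,2) zr(1) closed_simplex interior_simplex_2_nonempty by metis
  obtain w s where ws: "2 simplex X" "vertices X \<subseteq> S" "vertices X \<subseteq> sphere w s" "ball w s \<inter> S = {}"
    using X(1) sub unfolding delaunay_def by blast
  define g where "g = 2 *\<^sub>R (w - z)"
  define k where "k = r\<^sup>2 - s\<^sup>2 - (z \<bullet> z - w \<bullet> w)"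
  have diff: "((dist z x)\<^sup>2 - r\<^sup>2) - ((dist w x)\<^sup>2 - s\<^sup>2) = g \<bullet> x - k" for x
    using power_difference_affine[of z x w] by (simp add: g_def k_def)
  have nonneg: "0 \<le> (dist q x)\<^sup>2 - \<rho>\<^sup>2" if "ball q \<rho> \<inter> S = {}" "x \<in> S" "V \<subseteq> sphere q \<rho>" "V \<noteq> {}" for q x \<rho> V
  proof -
    have "\<rho> \<ge> 0" using that(3,4) by auto
    moreover have "\<rho> \<le> dist q x" using that(1,2) by (auto simp: disjoint_iff not_less)
    ultimately show ?thesis by (simp add: power_mono)
  qed
  have ne: "vertices T \<noteq> {}" "vertices X \<noteq> {}"
    using simplex_2_vertices(2)[OF zr(1)] simplex_2_vertices(2)[OF ws(1)] by auto
  have "g \<bullet> x \<le> k" if "x \<in> vertices T" for x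
  proof -
    have "0 \<le> (dist w x)\<^sup>2 - s\<^sup>2" using nonneg[OF ws(4) _ ws(3) ne(2)] that zr(2) by blast
    moreover have "(dist z x)\<^sup>2 - r\<^sup>2 = 0" using zr(3) that by auto
    ultimately show ?thesis using diff[of x] by linarith
  qed
  then have "convex hull vertices T \<subseteq> {x. g \<bullet> x \<le> k}"
    by (intro hull_minimal convex_halfspace_le) auto
  then have le: "g \<bullet> x \<le> k" if "x \<in> T" for x
    using that simplex_2_vertices(4)[OF zr(1)] by blast
  have "g \<bullet> x \<ge> k" if "x \<in> vertices X" for x
  proof -
    have "0 \<le> (dist z x)\<^sup>2 - r\<^sup>2" using nonneg[OF zr(4) _ zr(3) ne(1)] that ws(2) by blast
    moreover have "(dist w x)\<^sup>2 - s\<^sup>2 = 0" using ws(3) that by auto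
    ultimately show ?thesis using diff[of x] by linarith
  qed
  then have "convex hull vertices X \<subseteq> {x. g \<bullet> x \<ge> k}"
    by (intro hull_minimal convex_halfspace_ge) auto
  then have ge: "g \<bullet> x \<ge> k" if "x \<in> X" for x
    using that simplex_2_vertices(4)[OF ws(1)] by blast
  have "g \<bullet> x = k" if "x \<in> interior (T \<inter> X)" for x
    using le[of x] ge[of x] that interior_subset by fastforce
  then have "g = 0" "k = 0" using affine_vanishing_on_open[OF open_interior X(2)] by blast+
  moreover have "r \<ge> 0" "s \<ge> 0" using ws(3) zr(3) ne by auto
  ultimately have "vertices X \<subseteq> sphere z r"
    using ws(3) by (simp add: g_def k_def power2_eq_iff_nonneg)
  show "T \<in> t"
  proof (cases "vertices T = vertices X")
    case True
    then show ?thesis using X(1) simplex_2_vertices(4)[OF zr(1)] simplex_2_vertices(4)[OF ws(1)] by metis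
  next
    case False
    have fin: "finite (vertices T)" "finite (vertices X)"
      using simplex_2_vertices(1) zr(1) ws(1) by auto
    \<comment> \<open>Two different vertex sets of size three would put at least four points of
      \<open>S\<close> on one circle.\<close>
    have "vertices T \<subset> vertices T \<union> vertices X"
      using False card_subset_eq[OF fin(1), of "vertices X"] simplex_2_vertices(2)[OF zr(1)] simplex_2_vertices(2)[OF ws(1)]
        card_subset_eq[OF fin(1)] card_subset_eq[OF fin(2)] by (metis Un_upper1 Un_upper2 psubsetI)
    then have "4 \<le> card (vertices T \<union> vertices X)"
      using psubset_card_mono[of "vertices T \<union> vertices X" "vertices T"] fin simplex_2_vertices(2)[OF zr(1)] by simp
    then obtain Q where "Q \<subseteq> vertices T \<union> vertices X" "card Q = 4" by (meson obtain_subset_with_card_n)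
    then show ?thesis using circ[of Q z r] zr(2,3) ws(2) \<open>vertices X \<subseteq> sphere z r\<close> by blast
  qed
qed

text \<open>Each triangle is the hull of a subset of \<open>S\<close>, so a triangulation is a
  subset of a fixed finite set.\<close>

lemma finite_triangulations:
  assumes "finite S"
  shows "finite {t. triangulation_of S t}"
proof (rule finite_subset)
  show "{t. triangulation_of S t} \<subseteq> Pow ((hull) convex ` Pow S)"
  proof clarify
    fix t T assume t: "triangulation_of S t" and "T \<in> t"
    then have "T = convex hull vertices T" "vertices T \<in> Pow S"
      using triangulation_ofD[OF t] simplex_2_vertices(4) by blast+
    then show "T \<in> (hull) convex ` Pow S" by (rule image_eqI)
  qed
  show "finite (Pow ((hull) convex ` Pow S))" using assms by simp
qed

theorem theorem5:
  fixes S :: "(real ^ 2) set" and t :: "(real ^ 2) set set"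
  assumes "finite S"
    and "\<not> collinear S"
    and "\<And>Q c r. Q \<subseteq> S \<Longrightarrow> card Q = 4 \<Longrightarrow> \<not> Q \<subseteq> sphere c r"
    and "\<And>Q. Q \<subseteq> S \<Longrightarrow> card Q = 4 \<Longrightarrow> \<not> collinear Q"
    and "triangulation_of S t"
  shows "is_arg_min hrm (triangulation_of S) t \<longleftrightarrow> t = delaunay S"
proof -
  have min: "t' = delaunay S" if "is_arg_min hrm (triangulation_of S) t'" for t'
  proof -
    have t': "triangulation_of S t'" "\<And>t''. triangulation_of S t'' \<Longrightarrow> \<not> hrm t'' < hrm t'"
      using that by (auto simp: is_arg_min_def)
    have "t' \<subseteq> delaunay S" using not_delaunay_improves[OF t'(1) assms(3)] t'(2) by blast
    then show ?thesis using delaunay_subset[OF t'(1) assms(3)] by blast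
  qed
  \<comment> \<open>The given \<open>t\<close> ensures that a minimizer exists. By
    \<open>min\<close> it equals \<open>delaunay S\<close>, which is therefore minimizing itself;
    this is the converse direction.\<close>
  obtain t' where t': "is_arg_min hrm (triangulation_of S) t'"
    using ex_is_arg_min_if_finite[OF finite_triangulations[OF assms(1)], of hrm] assms(5)
    by (auto simp: is_arg_min_def)
  then show ?thesis using min by metis
qed

end
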